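(* Let $n,m\ge 1$ and let $\mathcal{A}:\mathbb{H}^{n\times n}\to\mathbb{R}^m$ be an arbitrary $\mathbb{R}$-linear operator. Let $\hat{x}\in\mathbb{C}^n$, $\hat{X}=\hat{x}\hat{x}^*$, $e\in\mathbb{R}^m$, and $b=\mathcal{A}(\hat{X})+e$. Suppose $\|b\|_2>\|e\|_2$ and $$\lambda>\frac{\|\mathcal{A}\|\,\|e\|_2}{\sqrt{2}-1}.$$ Consider the problems $$(\mathrm{P}_1)\qquad \min_{X\in\mathbb{C}^{n\times n}}\ \|\mathcal{A}(X)-b\|_2^2\quad\text{s.t.}\quad X\succeq 0,\ \operatorname{rank}(X)=1,$$ $$(\mathrm{P}_2)\qquad \min_{X\in\mathbb{C}^{n\times n}}\ \varphi(X):=\tfrac12\|\mathcal{A}(X)-b\|_2^2+\lambda\left(\operatorname{Tr}(X)-\|X\|_F\right)\quad\text{s.t.}\quad X\succeq 0.$$ If $X^{\mathrm{opt}}$ is a solution (global minimizer) of $(\mathrm{P}_2)$, then $\operatorname{rank}(X^{\mathrm{opt}})=1$. Moreover, $(\mathrm{P}_1)$ and $(\mathrm{P}_2)$ are equivalent in the sense that they have the same set of solutions (global minimizers).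
   Context: $\mathbb{H}^{n\times n}$ is the real vector space of $n\times n$ complex Hermitian matrices with inner product $\langle X,Y\rangle=\operatorname{Tr}(X^*Y)$ and Frobenius norm $\|X\|_F=\sqrt{\langle X,X\rangle}$. $X\succeq0$ means $X$ is Hermitian positive semidefinite. The operator norm is $\|\mathcal{A}\|=\sup_{X\in\mathbb{H}^{n\times n}\setminus\{0\}}\|\mathcal{A}(X)\|_2/\|X\|_F$. *)

theory Defs
  imports "HOL-Analysis.Analysis"
begin

subsection \<open>Hermitian matrices\<close>

definition conj_transpose :: "complex^'n^'m \<Rightarrow> complex^'m^'n" where
  "conj_transpose X = (\<chi> i j. cnj (X $ j $ i))"

definition hermitian :: "complex^'n^'n \<Rightarrow> bool" where
  "hermitian X \<longleftrightarrow> conj_transpose X = X"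

text \<open>The quadratic form \<open>v\<^sup>* X v\<close> is real for Hermitian \<open>X\<close>, so taking its real part loses nothing.\<close>

definition psd :: "complex^'n^'n \<Rightarrow> bool" where
  "psd X \<longleftrightarrow> hermitian X \<and> (\<forall>v. 0 \<le> Re (\<Sum>i\<in>UNIV. cnj (v $ i) * (X *v v) $ i))"

text \<open>The rank-one matrix \<open>x x\<^sup>*\<close>.\<close>

definition outer :: "complex^'n \<Rightarrow> complex^'n^'n" where
  "outer x = (\<chi> i j. x $ i * cnj (x $ j))"

text \<open>\<open>Tr (X\<^sup>* Y)\<close> is real on Hermitian matrices (\<open>trace_conj_transpose_mult_real\<close> below);
  the real part only serves to land in type \<^typ>\<open>real\<close>.\<close>

definition frob_inner :: "complex^'n^'n \<Rightarrow> complex^'n^'n \<Rightarrow> real" where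
  "frob_inner X Y = Re (trace (conj_transpose X ** Y))"

definition frob_norm :: "complex^'n^'n \<Rightarrow> real" where
  "frob_norm X = sqrt (frob_inner X X)"

lemma trace_conj_transpose_mult_real:
  assumes "hermitian X" "hermitian Y"
  shows "trace (conj_transpose X ** Y) \<in> \<real>"
proof -
  have X: "cnj (X $ i $ j) = X $ j $ i" and Y: "cnj (Y $ i $ j) = Y $ j $ i" for i j
    using assms by (auto simp: hermitian_def conj_transpose_def vec_eq_iff)
  have "trace (conj_transpose X ** Y) = (\<Sum>i\<in>UNIV. \<Sum>k\<in>UNIV. X $ i $ k * Y $ k $ i)"
    by (simp add: trace_def matrix_matrix_mult_def conj_transpose_def X)
  moreover have "cnj (\<Sum>i\<in>UNIV. \<Sum>k\<in>UNIV. X $ i $ k * Y $ k $ i)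
      = (\<Sum>i\<in>UNIV. \<Sum>k\<in>UNIV. X $ k $ i * Y $ i $ k)"
    by (simp add: X Y)
  moreover have "\<dots> = (\<Sum>i\<in>UNIV. \<Sum>k\<in>UNIV. X $ i $ k * Y $ k $ i)"
    by (rule sum.swap)
  ultimately show ?thesis
    by (simp add: Reals_cnj_iff)
qed

lemma frob_inner_eq_inner: "frob_inner X Y = X \<bullet> Y"
proof -
  have "frob_inner X Y = (\<Sum>i\<in>UNIV. \<Sum>k\<in>UNIV. X $ k $ i \<bullet> Y $ k $ i)"
    by (simp add: frob_inner_def trace_def matrix_matrix_mult_def conj_transpose_def
        inner_complex_def)
  also have "\<dots> = X \<bullet> Y"
    unfolding inner_vec_def by (rule sum.swap)
  finally show ?thesis .
qed

lemma frob_norm_eq_norm: "frob_norm X = norm X"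
  by (simp add: frob_norm_def frob_inner_eq_inner norm_eq_sqrt_inner)

subsection \<open>Linear operators on the Hermitian matrices\<close>

text \<open>The Hermitian matrices form a real subspace of \<^typ>\<open>complex^'n^'n\<close>, so an operator on them is
  represented by a function on all matrices whose values off that subspace are irrelevant.\<close>

definition linear_on_hermitian :: "(complex^'n^'n \<Rightarrow> real^'m) \<Rightarrow> bool" where
  "linear_on_hermitian \<A> \<longleftrightarrow>
    (\<forall>X Y. hermitian X \<longrightarrow> hermitian Y \<longrightarrow> \<A> (X + Y) = \<A> X + \<A> Y) \<and>
    (\<forall>c X. hermitian X \<longrightarrow> \<A> (c *\<^sub>R X) = c *\<^sub>R \<A> X)"

definition op_norm :: "(complex^'n^'n \<Rightarrow> real^'m) \<Rightarrow> real" where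
  "op_norm \<A> = (SUP X\<in>{X. hermitian X \<and> X \<noteq> 0}. norm (\<A> X) / frob_norm X)"

text \<open>The supremum is taken over a nonempty set that is bounded above, hence is a genuine one.\<close>

lemma op_norm_set_nonempty: "{X :: complex^'n^'n. hermitian X \<and> X \<noteq> 0} \<noteq> {}"
proof -
  have "hermitian (mat 1 :: complex^'n^'n)" and "(mat 1 :: complex^'n^'n) \<noteq> 0"
    by (auto simp: hermitian_def conj_transpose_def mat_def vec_eq_iff)
  then show ?thesis by blast
qed

lemma op_norm_set_bdd_above:
  fixes \<A> :: "complex^'n^'n \<Rightarrow> real^'m"
  assumes "linear_on_hermitian \<A>"
  shows "bdd_above ((\<lambda>X. norm (\<A> X) / frob_norm X) ` {X. hermitian X \<and> X \<noteq> 0})"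
proof -
  define h :: "complex^'n^'n \<Rightarrow> complex^'n^'n" where "h X = (1/2) *\<^sub>R (X + conj_transpose X)" for X
  have herm: "hermitian (h X)" for X
    by (simp add: h_def hermitian_def conj_transpose_def vec_eq_iff add.commute)
  have h_id: "h X = X" if "hermitian X" for X
    using that by (simp add: h_def hermitian_def flip: scaleR_2)
  have h_add: "h (X + Y) = h X + h Y" for X Y
    by (simp add: h_def conj_transpose_def vec_eq_iff algebra_simps)
  have h_scale: "h (c *\<^sub>R X) = c *\<^sub>R h X" for c X
    by (simp add: h_def conj_transpose_def vec_eq_iff algebra_simps)
  have "linear (\<A> \<circ> h)"
    using assms herm by (intro linearI) (simp_all add: linear_on_hermitian_def h_add h_scale)
  then obtain B where B: "\<And>X. norm ((\<A> \<circ> h) X) \<le> B * norm X"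
    using linear_bounded by blast
  have "norm (\<A> X) / frob_norm X \<le> B" if "hermitian X" "X \<noteq> 0" for X
    using B[of X] that by (simp add: h_id frob_norm_eq_norm divide_le_eq)
  then show ?thesis by (intro bdd_aboveI) auto
qed

subsection \<open>The two optimization problems\<close>

definition P1_objective :: "(complex^'n^'n \<Rightarrow> real^'m) \<Rightarrow> real^'m \<Rightarrow> complex^'n^'n \<Rightarrow> real" where
  "P1_objective \<A> b X = (norm (\<A> X - b))\<^sup>2"

definition P1_feasible :: "complex^'n^'n \<Rightarrow> bool" where
  "P1_feasible X \<longleftrightarrow> psd X \<and> rank X = 1"

text \<open>Feasible points are Hermitian, so their trace is real.\<close>

definition P2_objective ::
  "(complex^'n^'n \<Rightarrow> real^'m) \<Rightarrow> real^'m \<Rightarrow> real \<Rightarrow> complex^'n^'n \<Rightarrow> real" where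
  "P2_objective \<A> b lam X =
    1/2 * (norm (\<A> X - b))\<^sup>2 + lam * (Re (trace X) - frob_norm X)"

text \<open>\<^term>\<open>is_arg_min f P x\<close> says that \<open>x\<close> is a global minimizer of \<open>f\<close> subject to \<open>P\<close>.\<close>

definition P1_solutions :: "(complex^'n^'n \<Rightarrow> real^'m) \<Rightarrow> real^'m \<Rightarrow> (complex^'n^'n) set" where
  "P1_solutions \<A> b = {X. is_arg_min (P1_objective \<A> b) P1_feasible X}"

definition P2_solutions ::
  "(complex^'n^'n \<Rightarrow> real^'m) \<Rightarrow> real^'m \<Rightarrow> real \<Rightarrow> (complex^'n^'n) set" where
  "P2_solutions \<A> b lam = {X. is_arg_min (P2_objective \<A> b lam) psd X}"

end

theory Submission
  imports Defs
begin

text \<open>On positive semidefinite matrices the penalty \<open>Tr X - \<parallel>X\<parallel>\<close> is nonnegative, and it vanishes at rank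
  one (\<open>psd_norm_le_trace\<close>, \<open>psd_rank_1_trace_eq_norm\<close>). So on rank-one matrices the penalized
  objective \<open>\<phi>\<close> is half the least-squares objective, and \<open>\<phi> (Xhat) = \<parallel>e\<parallel>\<^sup>2 / 2\<close>. It remains to see
  that matrices of other rank never help in the penalized problem.

  A psd matrix \<open>X\<close> with \<open>\<phi> X \<le> \<parallel>e\<parallel>\<^sup>2 / 2\<close> has residual at most \<open>\<parallel>e\<parallel> < \<parallel>b\<parallel>\<close>, hence is nonzero. If its
  rank is not one, its range contains an orthonormal pair \<open>u1\<close>, \<open>u2\<close>. Let \<open>D\<close> be the orthogonal
  projection onto the span of that pair, so \<open>Tr D = 2\<close> and \<open>\<parallel>D\<parallel> = sqrt 2\<close>. For small \<open>t > 0\<close> the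
  matrix \<open>X - t D\<close> is still psd. To first order in \<open>t\<close>, the penalty drops by at least
  \<open>\<lambda> (2 - sqrt 2) t\<close>, while the data term rises by at most
  \<open>\<parallel>\<A>\<parallel> \<parallel>e\<parallel> sqrt 2 t\<close>. The bound on \<open>\<lambda>\<close> says exactly that the drop is the larger of the two, so
  \<open>\<phi>\<close> strictly decreases (\<open>P2_descent\<close>). In particular a minimizer of \<open>\<phi>\<close> has rank one.

  For the equality of the two solution sets one must also exclude that the least-squares problem has
  a solution while \<open>\<phi>\<close> has a smaller infimum that is not attained: \<open>\<phi>\<close> need not be coercive, since
  \<open>\<A>\<close> may have rank-one matrices in its kernel. But the descent step also decreases the trace, so the
  same argument applies to a minimizer of \<open>\<phi>\<close> on the compact set of psd matrices with trace at
  most \<open>Tr Y\<close>. Hence every psd \<open>Y\<close> is dominated by a psd matrix of rank one, strictly if \<open>Y\<close> itself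
  does not have rank one (\<open>rank_1_dominates\<close>); both claims follow from this.\<close>

section \<open>The complex scalar product\<close>

definition cdot :: "complex^'n \<Rightarrow> complex^'n \<Rightarrow> complex" where
  "cdot v w = (\<Sum>i\<in>UNIV. cnj (v $ i) * w $ i)"

lemma cdot_add_right: "cdot u (v + w) = cdot u v + cdot u w"
  and cdot_diff_left: "cdot (u - v) w = cdot u w - cdot v w"
  and cdot_diff_right: "cdot u (v - w) = cdot u v - cdot u w"
  and cdot_scale_left: "cdot (c *s v) w = cnj c * cdot v w"
  and cdot_scale_right: "cdot v (c *s w) = c * cdot v w"
  and cdot_commute: "cdot w v = cnj (cdot v w)"
  unfolding cdot_def
  by (auto simp: algebra_simps sum.distrib sum_subtractf sum_distrib_left)

lemma cdot_scaleR_right: "cdot v (r *\<^sub>R w) = of_real r * cdot v w"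
  unfolding cdot_def vector_scaleR_component
  by (simp add: scaleR_conv_of_real sum_distrib_left mult_ac)

lemma of_real_cmod_squared: "(of_real (cmod z))\<^sup>2 = z * cnj z"
  by (simp only: complex_norm_square flip: of_real_power)

lemma cdot_self: "cdot v v = of_real ((norm v)\<^sup>2)"
proof -
  have "(norm v)\<^sup>2 = (\<Sum>i\<in>UNIV. (cmod (v $ i))\<^sup>2)"
    by (simp add: norm_vec_def L2_set_def sum_nonneg)
  then show ?thesis
    by (simp add: cdot_def of_real_cmod_squared mult.commute)
qed

lemma cdot_axis_left: "cdot (axis i 1) v = v $ i"
proof -
  have "cnj (axis i 1 $ k) * v $ k = (if k = i then v $ k else 0)" for k
    by (simp add: axis_def)
  then show ?thesis by (simp add: cdot_def)
qed

lemma cdot_hermitian: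
  assumes "hermitian X"
  shows "cdot v (X *v w) = cnj (cdot w (X *v v))"
proof -
  have X: "cnj (X $ i $ j) = X $ j $ i" for i j
    using assms by (auto simp: hermitian_def conj_transpose_def vec_eq_iff)
  have "cdot v (X *v w) = (\<Sum>i\<in>UNIV. \<Sum>j\<in>UNIV. cnj (v $ i) * (X $ i $ j * w $ j))"
    by (simp add: cdot_def matrix_vector_mult_def sum_distrib_left)
  also have "\<dots> = (\<Sum>j\<in>UNIV. \<Sum>i\<in>UNIV. cnj (v $ i) * (X $ i $ j * w $ j))"
    by (rule sum.swap)
  also have "\<dots> = cnj (cdot w (X *v v))"
    by (simp add: cdot_def matrix_vector_mult_def sum_distrib_left X mult_ac)
  finally show ?thesis .
qed

section \<open>Positive semidefinite matrices\<close>

lemma psd_iff: "psd X \<longleftrightarrow> hermitian X \<and> (\<forall>v. 0 \<le> Re (cdot v (X *v v)))"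
  by (simp add: psd_def cdot_def)

text \<open>The usual discriminant argument. The form may be degenerate, so \<open>w\<close> with \<open>w\<^sup>* X w = 0\<close> is treated
  separately, by letting the parameter of the quadratic grow.\<close>

lemma psd_cauchy_schwarz:
  assumes "psd X"
  shows "(cmod (cdot v (X *v w)))\<^sup>2 \<le> Re (cdot v (X *v v)) * Re (cdot w (X *v w))"
proof -
  have herm: "hermitian X" and nonneg: "0 \<le> Re (cdot u (X *v u))" for u
    using assms by (auto simp: psd_iff)
  define s where "s = cdot w (X *v v)"
  define a where "a = Re (cdot v (X *v v))"
  define c where "c = Re (cdot w (X *v w))"
  have vw: "cdot v (X *v w) = cnj s"
    unfolding s_def by (rule cdot_hermitian[OF herm])
  \<comment> \<open>positivity at \<open>v - t s w\<close>, where the factor \<open>s\<close> makes the cross terms real\<close>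
  have quadratic: "0 \<le> a - 2 * t * (cmod s)\<^sup>2 + t\<^sup>2 * (cmod s)\<^sup>2 * c" for t
  proof -
    define k where "k = of_real t * s"
    have "0 \<le> Re (cdot (v - k *s w) (X *v (v - k *s w)))" by (rule nonneg)
    also have "\<dots> = Re (cdot v (X *v v) - k * cnj s - cnj k * s + cnj k * k * cdot w (X *v w))"
      by (simp add: matrix_vector_mult_diff_distrib vector_scalar_commute
          cdot_diff_left cdot_diff_right cdot_scale_left cdot_scale_right vw
          flip: s_def) (simp add: algebra_simps)
    also have "k * cnj s = of_real (t * (cmod s)\<^sup>2)"
      by (simp add: k_def of_real_cmod_squared mult.assoc)
    also have "cnj k * s = of_real (t * (cmod s)\<^sup>2)"
      by (simp add: k_def of_real_cmod_squared mult_ac)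
    also have "cnj k * k = of_real (t\<^sup>2 * (cmod s)\<^sup>2)"
      by (simp add: k_def of_real_cmod_squared power2_eq_square[of "of_real t"] mult_ac)
    finally show ?thesis by (simp add: a_def c_def)
  qed
  have "(cmod s)\<^sup>2 \<le> a * c"
  proof (cases "c = 0")
    case True
    have "s = 0"
    proof (rule ccontr)
      assume "s \<noteq> 0"
      then show False
        using quadratic[of "(a + 1) / (cmod s)\<^sup>2"] nonneg[of v] True by (simp add: a_def)
    qed
    then show ?thesis using True by simp
  next
    case False
    then have "c > 0" using nonneg[of w] by (simp add: c_def)
    then show ?thesis using quadratic[of "1 / c"] by (simp add: field_simps power2_eq_square)
  qed
  then show ?thesis by (simp add: vw a_def c_def)
qed

lemma cdot_axis_axis: "cdot (axis i 1) (X *v axis j 1) = X $ i $ j"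
proof -
  have "X $ i $ k * axis j 1 $ k = (if k = j then X $ i $ k else 0)" for k
    by (simp add: axis_def)
  then show ?thesis by (simp add: cdot_axis_left matrix_vector_mult_def)
qed

lemma norm_matrix_squared:
  fixes X :: "complex^'n^'n"
  shows "(norm X)\<^sup>2 = (\<Sum>i\<in>UNIV. \<Sum>j\<in>UNIV. (cmod (X $ i $ j))\<^sup>2)"
  by (simp add: norm_vec_def L2_set_def sum_nonneg)

lemma Re_trace_squared:
  fixes X :: "complex^'n^'n"
  shows "(Re (trace X))\<^sup>2 = (\<Sum>i\<in>UNIV. \<Sum>j\<in>UNIV. Re (X $ i $ i) * Re (X $ j $ j))"
  by (simp add: trace_def power2_eq_square sum_product)

lemma psd_trace_nonneg:
  assumes "psd X"
  shows "0 \<le> Re (trace X)"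
  unfolding trace_def Re_sum
proof (rule sum_nonneg)
  fix i
  have "0 \<le> Re (cdot (axis i 1) (X *v axis i 1))"
    using assms by (simp add: psd_iff)
  then show "0 \<le> Re (X $ i $ i)" by (simp add: cdot_axis_axis)
qed

text \<open>Positivity of the \<open>2 \<times> 2\<close> principal minors bounds \<open>\<bar>X\<^sub>i\<^sub>j\<bar>\<^sup>2\<close> by \<open>X\<^sub>i\<^sub>i X\<^sub>j\<^sub>j\<close>; summing these bounds
  gives the square of the trace on the right.\<close>

lemma psd_norm_le_trace:
  assumes "psd X"
  shows "norm X \<le> Re (trace X)"
proof (rule power2_le_imp_le)
  have "(cmod (X $ i $ j))\<^sup>2 \<le> Re (X $ i $ i) * Re (X $ j $ j)" for i j
    using psd_cauchy_schwarz[OF assms, of "axis i 1" "axis j 1"] by (simp add: cdot_axis_axis)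
  then show "(norm X)\<^sup>2 \<le> (Re (trace X))\<^sup>2"
    unfolding norm_matrix_squared Re_trace_squared by (intro sum_mono)
qed (rule psd_trace_nonneg[OF assms])

lemma continuous_on_trace: "continuous_on S (\<lambda>X :: complex^'n^'n. Re (trace X))"
  unfolding trace_def by (intro continuous_intros)

lemma closed_psd: "closed {X :: complex^'n^'n. psd X}"
  unfolding psd_def hermitian_def conj_transpose_def vec_eq_iff matrix_vector_mult_def
  by (simp, intro closed_Collect_conj closed_Collect_all closed_Collect_eq closed_Collect_le
      continuous_intros)

lemma compact_psd_trace_le: "compact {X :: complex^'n^'n. psd X \<and> Re (trace X) \<le> R}"
proof -
  have "closed {X :: complex^'n^'n. psd X \<and> Re (trace X) \<le> R}"
    by (intro closed_Collect_conj closed_psd closed_Collect_le continuous_on_trace continuous_intros)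
  moreover have "bounded {X :: complex^'n^'n. psd X \<and> Re (trace X) \<le> R}"
    unfolding bounded_iff using psd_norm_le_trace order_trans by blast
  ultimately show ?thesis by (simp add: compact_eq_bounded_closed)
qed

section \<open>Rank one\<close>

lemma rank_eq_1_obtain:
  fixes X :: "complex^'n^'m"
  assumes "rank X = 1"
  obtains a y where "\<And>i j. X $ i $ j = a i * y $ j"
proof -
  obtain B where B: "rows X \<subseteq> vec.span B" "card B = vec.dim (rows X)"
    using vec.basis_exists[of "rows X"] by metis
  then obtain y where "B = {y}"
    using assms by (auto simp: row_rank_def_gen card_1_singleton_iff)
  with B have "\<exists>c. row i X = c *s y" for i
    by (auto simp: rows_def vec.span_singleton)
  then obtain a where "\<And>i. row i X = a i *s y" by metis
  then show thesis
    by (intro that[of a y]) (auto simp: row_def vec_eq_iff)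
qed

lemma rank_eq_1I:
  fixes X :: "complex^'n^'m"
  assumes "X \<noteq> 0" and "\<And>i j. X $ i $ j = a i * y j"
  shows "rank X = 1"
proof -
  have "row i X = a i *s (\<chi> j. y j)" for i
    using assms(2) by (simp add: row_def vec_eq_iff)
  then have "rows X \<subseteq> vec.span {\<chi> j. y j}"
    by (auto simp: rows_def vec.span_singleton)
  then have "rank X \<le> 1"
    using vec.dim_le_card[of "rows X" "{\<chi> j. y j}"] by (simp add: row_rank_def_gen)
  moreover have "rank X \<noteq> 0"
  proof
    assume "rank X = 0"
    then have "rows X \<subseteq> {0}" by (simp add: row_rank_def_gen vec.dim_eq_0)
    then have "row i X = 0" for i by (auto simp: rows_def)
    then show False using assms(1) by (simp add: row_def vec_eq_iff)
  qed
  ultimately show ?thesis by linarith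
qed

text \<open>At rank one the \<open>2 \<times> 2\<close> minors vanish, so the entrywise estimate behind \<open>psd_norm_le_trace\<close> is an
  equality.\<close>

lemma psd_rank_1_trace_eq_norm:
  assumes "psd X" "rank X = 1"
  shows "Re (trace X) = norm X"
proof (rule power2_eq_imp_eq)
  have herm: "cnj (X $ i $ j) = X $ j $ i" for i j
    using assms by (auto simp: psd_def hermitian_def conj_transpose_def vec_eq_iff)
  obtain a y where X: "\<And>i j. X $ i $ j = a i * y $ j"
    using rank_eq_1_obtain[OF assms(2)] by metis
  have diag: "X $ i $ i = of_real (Re (X $ i $ i))" for i
    using herm[of i i] by (simp add: complex_eq_iff)
  have "(cmod (X $ i $ j))\<^sup>2 = Re (X $ i $ i) * Re (X $ j $ j)" for i j
  proof -
    have "complex_of_real ((cmod (X $ i $ j))\<^sup>2) = X $ i $ j * X $ j $ i"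
      by (simp only: complex_norm_square herm)
    also have "\<dots> = X $ i $ i * X $ j $ j" by (simp add: X)
    also have "\<dots> = of_real (Re (X $ i $ i) * Re (X $ j $ j))"
      by (metis diag of_real_mult)
    finally show ?thesis using of_real_eq_iff by blast
  qed
  then show "(Re (trace X))\<^sup>2 = (norm X)\<^sup>2"
    unfolding norm_matrix_squared Re_trace_squared by simp
qed (use assms psd_trace_nonneg in auto)

lemma cdot_outer: "cdot v (outer u *v v) = of_real ((cmod (cdot v u))\<^sup>2)"
proof -
  have "outer u *v v = cdot u v *s u"
    by (simp add: vec_eq_iff outer_def matrix_vector_mult_def cdot_def sum_distrib_left
        sum_distrib_right mult_ac)
  then show ?thesis
    by (simp add: cdot_scale_right cdot_commute[of u v] of_real_cmod_squared mult.commute)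
qed

lemma hermitian_outer: "hermitian (outer u)"
  by (simp add: hermitian_def conj_transpose_def outer_def mult.commute)

lemma psd_outer: "psd (outer u)"
  by (simp add: psd_iff hermitian_outer cdot_outer)

lemma rank_outer: "outer u \<noteq> 0 \<Longrightarrow> rank (outer u) = 1"
  by (rule rank_eq_1I) (simp_all add: outer_def)

lemma trace_outer: "trace (outer u) = of_real ((norm u)\<^sup>2)"
  unfolding cdot_self[symmetric] by (simp add: trace_def outer_def cdot_def mult.commute)

lemma inner_outer: "outer u \<bullet> outer v = (cmod (cdot u v))\<^sup>2"
proof -
  have "outer u \<bullet> outer v
      = Re (\<Sum>i\<in>UNIV. \<Sum>j\<in>UNIV. (cnj (u $ i) * v $ i) * (u $ j * cnj (v $ j)))"
    by (simp add: inner_vec_def outer_def inner_complex_def algebra_simps)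
  also have "\<dots> = Re (cdot u v * cnj (cdot u v))"
    by (simp add: cdot_def sum_product)
  finally show ?thesis by (simp flip: complex_norm_square)
qed

section \<open>Subtracting projections onto the range\<close>

lemma matrix_vector_mult_scaleR_right: "X *v (r *\<^sub>R v) = r *\<^sub>R (X *v (v :: complex^'n))"
  by (simp add: vec_eq_iff matrix_vector_mult_def scaleR_sum_right)

text \<open>One Gram--Schmidt step on the columns: if subtracting the component along a first unit column left
  nothing of any other column, all columns would be parallel and the rank would be one. The vectors
  are delivered as images of \<open>w1\<close> and \<open>w2\<close> because \<open>psd_minus_outer_pair\<close> needs the preimages.\<close>

lemma orthonormal_pair_in_range:
  fixes X :: "complex^'n^'m"
  assumes "X \<noteq> 0" "rank X \<noteq> 1"
  obtains w1 w2 where "norm (X *v w1) = 1" "norm (X *v w2) = 1" "cdot (X *v w1) (X *v w2) = 0"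
proof -
  have col: "(X *v axis k 1) $ i = X $ i $ k" for i k
    using cdot_axis_axis[of i X k] by (simp add: cdot_axis_left)
  obtain k where k: "X *v axis k 1 \<noteq> 0"
    using assms(1) by (metis col vec_eq_iff zero_index)
  define w1 where "w1 = (1 / norm (X *v axis k 1)) *\<^sub>R axis k (1::complex)"
  define u where "u = X *v w1"
  have "norm u = 1"
    using k by (simp add: u_def w1_def matrix_vector_mult_scaleR_right)
  obtain l where l: "X *v axis l 1 \<noteq> cdot u (X *v axis l 1) *s u"
  proof (rule ccontr)
    assume "\<not> thesis"
    then have "X *v axis l 1 = cdot u (X *v axis l 1) *s u" for l using that by blast
    then have "X $ i $ l = u $ i * cdot u (X *v axis l 1)" for i l
      by (metis col mult.commute vector_smult_component)
    then have "rank X = 1" by (rule rank_eq_1I[OF assms(1)])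
    then show False using assms(2) by simp
  qed
  define w where "w = axis l 1 - cdot u (X *v axis l 1) *s w1"
  have Xw: "X *v w = X *v axis l 1 - cdot u (X *v axis l 1) *s u"
    by (simp add: w_def u_def matrix_vector_mult_diff_distrib vector_scalar_commute)
  have "cdot u (X *v w) = 0"
    by (simp add: Xw cdot_diff_right cdot_scale_right cdot_self \<open>norm u = 1\<close>)
  moreover have "X *v w \<noteq> 0" using l by (simp add: Xw)
  ultimately show thesis
    by (intro that[of w1 "(1 / norm (X *v w)) *\<^sub>R w"])
      (simp_all add: matrix_vector_mult_scaleR_right cdot_scaleR_right \<open>norm u = 1\<close> flip: u_def)
qed

lemma scaleR_matrix_vector_mult: "(t *\<^sub>R X) *v v = t *\<^sub>R (X *v (v :: complex^'n))"
  by (simp add: vec_eq_iff matrix_vector_mult_def scaleR_sum_right)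

text \<open>For \<open>u = X w\<close>, the Cauchy--Schwarz inequality of the form \<open>X\<close> reads
  \<open>\<bar>v\<^sup>* u\<bar>\<^sup>2 \<le> (w\<^sup>* X w) (v\<^sup>* X v)\<close> for all \<open>v\<close>, that is, \<open>u u\<^sup>* \<le> (w\<^sup>* X w) X\<close> in the psd order. So small
  multiples of projections onto subspaces of the range can be subtracted from \<open>X\<close>, with an
  explicit step size and without diagonalizing \<open>X\<close>.\<close>

lemma psd_minus_outer_pair:
  assumes "psd X" "t \<ge> 0"
    and "t * (Re (cdot w1 (X *v w1)) + Re (cdot w2 (X *v w2))) \<le> 1"
  shows "psd (X - t *\<^sub>R (outer (X *v w1) + outer (X *v w2)))"
    (is "psd (X - t *\<^sub>R ?D)")
proof -
  have "hermitian (X - t *\<^sub>R ?D)"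
    using assms(1) hermitian_outer[of "X *v w1"] hermitian_outer[of "X *v w2"]
    by (simp add: psd_def hermitian_def conj_transpose_def vec_eq_iff)
  moreover have "0 \<le> Re (cdot v ((X - t *\<^sub>R ?D) *v v))" for v
  proof -
    define q where "q = Re (cdot v (X *v v))"
    have "0 \<le> q" using assms(1) by (simp add: q_def psd_iff)
    have "t * ((cmod (cdot v (X *v w1)))\<^sup>2 + (cmod (cdot v (X *v w2)))\<^sup>2)
        \<le> t * (q * Re (cdot w1 (X *v w1)) + q * Re (cdot w2 (X *v w2)))"
      unfolding q_def
      by (intro mult_left_mono add_mono psd_cauchy_schwarz assms)
    also have "\<dots> = q * (t * (Re (cdot w1 (X *v w1)) + Re (cdot w2 (X *v w2))))"
      by (simp add: algebra_simps)
    also have "\<dots> \<le> q" using mult_left_mono[OF assms(3) \<open>0 \<le> q\<close>] by simp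
    finally have "t * ((cmod (cdot v (X *v w1)))\<^sup>2 + (cmod (cdot v (X *v w2)))\<^sup>2) \<le> q" .
    moreover have "Re (cdot v ((X - t *\<^sub>R ?D) *v v))
        = q - t * ((cmod (cdot v (X *v w1)))\<^sup>2 + (cmod (cdot v (X *v w2)))\<^sup>2)"
      by (simp add: q_def matrix_vector_mult_diff_rdistrib matrix_vector_mult_add_rdistrib
          scaleR_matrix_vector_mult cdot_diff_right cdot_add_right cdot_scaleR_right
          cdot_outer)
    ultimately show ?thesis by simp
  qed
  ultimately show ?thesis by (simp add: psd_iff)
qed

section \<open>The operator norm on Hermitian matrices\<close>

lemma op_norm_bound:
  assumes "linear_on_hermitian \<A>" "hermitian X"
  shows "norm (\<A> X) \<le> op_norm \<A> * norm X"
proof (cases "X = 0")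
  case True
  have "\<A> (0 *\<^sub>R X) = 0 *\<^sub>R \<A> X"
    using assms unfolding linear_on_hermitian_def by blast
  then show ?thesis using True by simp
next
  case False
  have "norm (\<A> X) / frob_norm X \<le> op_norm \<A>"
    unfolding op_norm_def
    by (rule cSUP_upper[OF _ op_norm_set_bdd_above[OF assms(1)]]) (use assms False in simp)
  then show ?thesis using False by (simp add: frob_norm_eq_norm divide_le_eq)
qed

lemma op_norm_nonneg:
  assumes "linear_on_hermitian (\<A> :: complex^'n^'n \<Rightarrow> real^'m)"
  shows "0 \<le> op_norm \<A>"
proof -
  obtain X :: "complex^'n^'n" where "hermitian X" "X \<noteq> 0" using op_norm_set_nonempty by blast
  then have "0 \<le> op_norm \<A> * norm X"
    using op_norm_bound[OF assms] norm_ge_zero order_trans by blast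
  then show ?thesis using \<open>X \<noteq> 0\<close> by (simp add: zero_le_mult_iff)
qed

lemma linear_on_hermitian_diff_scaleR:
  assumes "linear_on_hermitian \<A>" "hermitian X" "hermitian Y"
  shows "\<A> (X - t *\<^sub>R Y) = \<A> X - t *\<^sub>R \<A> Y"
proof -
  have "hermitian ((- t) *\<^sub>R Y)"
    using assms(3) by (simp add: hermitian_def conj_transpose_def vec_eq_iff)
  then have "\<A> (X + (- t) *\<^sub>R Y) = \<A> X + (- t) *\<^sub>R \<A> Y"
    using assms unfolding linear_on_hermitian_def by metis
  then show ?thesis by simp
qed

section \<open>Strict descent\<close>

text \<open>The step is \<open>X - t D\<close> with \<open>D\<close> the projection onto a plane in the range of \<open>X\<close>. Using a plane
  rather than a line is what yields the constant \<open>sqrt 2 - 1\<close>: the ratio of \<open>Tr D - \<parallel>D\<parallel>\<close> to \<open>\<parallel>D\<parallel>\<close> is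
  \<open>sqrt r - 1\<close> for a projection of rank \<open>r\<close>. The trace bound on \<open>Y\<close> keeps the step inside
  trace-bounded sets, on which minimizers exist.\<close>

lemma P2_descent:
  fixes \<A> :: "complex^'n^'n \<Rightarrow> real^'m"
  assumes lin: "linear_on_hermitian \<A>"
    and psd: "psd X" and "X \<noteq> 0" "rank X \<noteq> 1"
    and residual: "op_norm \<A> * norm (\<A> X - b) < lam * (sqrt 2 - 1)" and "lam \<ge> 0"
  obtains Y where "psd Y" "Re (trace Y) \<le> Re (trace X)"
    "P2_objective \<A> b lam Y < P2_objective \<A> b lam X"
proof -
  obtain w1 w2 where unit: "norm (X *v w1) = 1" "norm (X *v w2) = 1"
      and orth: "cdot (X *v w1) (X *v w2) = 0"
    using orthonormal_pair_in_range[OF assms(3,4)] .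
  define D where "D = outer (X *v w1) + outer (X *v w2)"
  have herm_D: "hermitian D"
    using hermitian_outer[of "X *v w1"] hermitian_outer[of "X *v w2"]
    by (simp add: D_def hermitian_def conj_transpose_def vec_eq_iff)
  have trace_D: "trace D = 2" by (simp add: D_def trace_add trace_outer unit)
  have "D \<bullet> D = 2"
    using orth cdot_commute[of "X *v w2" "X *v w1"]
    by (simp add: D_def inner_add_left inner_add_right inner_outer cdot_self unit)
  then have norm_D: "norm D = sqrt 2" by (simp add: norm_eq_sqrt_inner)
  define r where "r = \<A> X - b"
  \<comment> \<open>the guaranteed first-order rate of decrease of the objective along \<open>- D\<close>\<close>
  define \<delta> where "\<delta> = lam * (2 - sqrt 2) - norm r * norm (\<A> D)"
  have "norm r * norm (\<A> D) \<le> norm r * (op_norm \<A> * sqrt 2)"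
    using op_norm_bound[OF lin herm_D] by (simp add: norm_D mult_left_mono)
  also have "\<dots> = sqrt 2 * (op_norm \<A> * norm (\<A> X - b))" by (simp add: r_def)
  also have "\<dots> < sqrt 2 * (lam * (sqrt 2 - 1))" using residual by simp
  also have "\<dots> = lam * (2 - sqrt 2)" by (simp add: algebra_simps)
  finally have "\<delta> > 0" by (simp add: \<delta>_def)
  define c where "c = Re (cdot w1 (X *v w1)) + Re (cdot w2 (X *v w2))"
  have "c \<ge> 0" using psd by (simp add: c_def psd_iff)
  \<comment> \<open>the first bound keeps \<open>X - t D\<close> psd; the second keeps the quadratic term \<open>t\<^sup>2 \<parallel>\<A> D\<parallel>\<^sup>2 / 2\<close> below \<open>t \<delta>\<close>\<close>
  define t where "t = min (1 / (c + 1)) (\<delta> / ((norm (\<A> D))\<^sup>2 + 1))"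
  have "t > 0" using \<open>c \<ge> 0\<close> \<open>\<delta> > 0\<close> by (simp add: t_def add_nonneg_pos)
  have "t \<le> 1 / (c + 1)" by (simp add: t_def)
  then have "t * (c + 1) \<le> 1"
    using \<open>c \<ge> 0\<close> by (simp add: pos_le_divide_eq)
  then have "t * c \<le> 1" using \<open>t > 0\<close> by (simp add: algebra_simps)
  have "t \<le> \<delta> / ((norm (\<A> D))\<^sup>2 + 1)" by (simp add: t_def)
  then have "t * ((norm (\<A> D))\<^sup>2 + 1) \<le> \<delta>"
    by (simp add: pos_le_divide_eq add_nonneg_pos)
  then have small: "t * (norm (\<A> D))\<^sup>2 < \<delta>" using \<open>t > 0\<close> by (simp add: algebra_simps)
  show thesis
  proof (rule that[of "X - t *\<^sub>R D"])
    show "psd (X - t *\<^sub>R D)"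
      unfolding D_def using psd \<open>t > 0\<close> \<open>t * c \<le> 1\<close>
      by (intro psd_minus_outer_pair) (auto simp: c_def)
    have trace: "Re (trace (X - t *\<^sub>R D)) = Re (trace X) - 2 * t"
    proof -
      have "trace (t *\<^sub>R D) = t *\<^sub>R trace D" by (simp add: trace_def scaleR_sum_right)
      then show ?thesis by (simp add: trace_sub trace_D)
    qed
    then show "Re (trace (X - t *\<^sub>R D)) \<le> Re (trace X)" using \<open>t > 0\<close> by simp
    \<comment> \<open>the triangle inequality replaces the derivative of the norm at \<open>X\<close>\<close>
    have "norm X \<le> norm (X - t *\<^sub>R D) + t * sqrt 2"
      using norm_triangle_ineq[of "X - t *\<^sub>R D" "t *\<^sub>R D"] \<open>t > 0\<close> by (simp add: norm_D)
    then have pen: "lam * (norm X - t * sqrt 2) \<le> lam * norm (X - t *\<^sub>R D)"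
      using \<open>lam \<ge> 0\<close> by (intro mult_left_mono) auto
    have "\<A> (X - t *\<^sub>R D) - b = r - t *\<^sub>R \<A> D"
      using linear_on_hermitian_diff_scaleR[OF lin _ herm_D] psd by (simp add: psd_def r_def)
    then have "(norm (\<A> (X - t *\<^sub>R D) - b))\<^sup>2
        = (norm r)\<^sup>2 - 2 * t * (r \<bullet> \<A> D) + t\<^sup>2 * (norm (\<A> D))\<^sup>2"
      by (simp only: power2_norm_eq_inner)
        (simp add: inner_diff_left inner_diff_right inner_commute power2_eq_square algebra_simps)
    also have "\<dots> \<le> (norm r)\<^sup>2 + 2 * t * (norm r * norm (\<A> D)) + t\<^sup>2 * (norm (\<A> D))\<^sup>2"
    proof -
      have "- (r \<bullet> \<A> D) \<le> norm r * norm (\<A> D)"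
        using Cauchy_Schwarz_ineq2[of r "\<A> D"] by linarith
      then have "2 * t * - (r \<bullet> \<A> D) \<le> 2 * t * (norm r * norm (\<A> D))"
        using \<open>t > 0\<close> by (intro mult_left_mono) auto
      then show ?thesis by simp
    qed
    finally have fit: "(norm (\<A> (X - t *\<^sub>R D) - b))\<^sup>2
      \<le> (norm r)\<^sup>2 + 2 * t * (norm r * norm (\<A> D)) + t\<^sup>2 * (norm (\<A> D))\<^sup>2" .
    have "P2_objective \<A> b lam (X - t *\<^sub>R D)
        \<le> P2_objective \<A> b lam X - t * (\<delta> - t * (norm (\<A> D))\<^sup>2 / 2)"
      using fit pen unfolding P2_objective_def frob_norm_eq_norm trace
      by (simp add: \<delta>_def algebra_simps power2_eq_square flip: r_def)
    moreover have "0 < t * (\<delta> - t * (norm (\<A> D))\<^sup>2 / 2)"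
      using \<open>t > 0\<close> small \<open>\<delta> > 0\<close> by (intro mult_pos_pos) auto
    ultimately show "P2_objective \<A> b lam (X - t *\<^sub>R D) < P2_objective \<A> b lam X" by linarith
  qed
qed

section \<open>Equivalence of the two problems\<close>

text \<open>On Hermitian matrices the operator norm is a Lipschitz constant of the operator.\<close>

lemma continuous_on_P2_objective:
  fixes \<A> :: "complex^'n^'n \<Rightarrow> real^'m"
  assumes lin: "linear_on_hermitian \<A>" and S: "\<And>X. X \<in> S \<Longrightarrow> hermitian X"
  shows "continuous_on S (P2_objective \<A> b lam)"
proof -
  have "(op_norm \<A>)-lipschitz_on S \<A>"
  proof (rule lipschitz_onI)
    fix X Y assume "X \<in> S" "Y \<in> S"
    then have "hermitian X" "hermitian Y" using S by auto
    moreover from this have "hermitian (X - Y)"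
      by (simp add: hermitian_def conj_transpose_def vec_eq_iff)
    ultimately show "dist (\<A> X) (\<A> Y) \<le> op_norm \<A> * dist X Y"
      using linear_on_hermitian_diff_scaleR[OF lin, of X Y 1] op_norm_bound[OF lin, of "X - Y"]
      by (simp add: dist_norm)
  qed (rule op_norm_nonneg[OF lin])
  then have "continuous_on S \<A>" by (rule lipschitz_on_continuous_on)
  then show ?thesis
    unfolding P2_objective_def frob_norm_eq_norm
    by (intro continuous_intros continuous_on_trace)
qed

lemma P2_objective_rank_1:
  assumes "psd X" "rank X = 1"
  shows "P2_objective \<A> b lam X = P1_objective \<A> b X / 2"
  using psd_rank_1_trace_eq_norm[OF assms]
  by (simp add: P2_objective_def P1_objective_def frob_norm_eq_norm)

lemma norm_residual_le:
  assumes "psd X" "lam \<ge> 0" "P2_objective \<A> b lam X \<le> \<epsilon>\<^sup>2 / 2" "\<epsilon> \<ge> 0"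
  shows "norm (\<A> X - b) \<le> \<epsilon>"
proof (rule power2_le_imp_le)
  have "0 \<le> lam * (Re (trace X) - norm X)"
    using psd_norm_le_trace[OF assms(1)] assms(2) by simp
  then show "(norm (\<A> X - b))\<^sup>2 \<le> \<epsilon>\<^sup>2"
    using assms(3) by (simp add: P2_objective_def frob_norm_eq_norm)
qed fact

text \<open>A minimizer \<open>Z\<close> of the objective under the additional constraint \<open>Tr X \<le> Tr Y\<close> exists by
  compactness. It has rank one, since the descent step from any other \<open>Z\<close> would respect that
  constraint. The level \<open>\<epsilon>\<^sup>2 / 2\<close> with \<open>\<epsilon> < \<parallel>b\<parallel>\<close> keeps the residuals below \<open>\<parallel>b\<parallel>\<close> and thereby excludes
  \<open>X = 0\<close>, the one psd matrix that the trace constraint does not allow to leave.\<close>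

lemma rank_1_dominates:
  fixes \<A> :: "complex^'n^'n \<Rightarrow> real^'m"
  assumes lin: "linear_on_hermitian \<A>"
    and lam: "op_norm \<A> * \<epsilon> < lam * (sqrt 2 - 1)" "lam \<ge> 0"
    and eps: "0 \<le> \<epsilon>" "\<epsilon> < norm b"
    and Y: "psd Y" "P2_objective \<A> b lam Y \<le> \<epsilon>\<^sup>2 / 2"
  obtains Z where "psd Z" "rank Z = 1" "P2_objective \<A> b lam Z \<le> P2_objective \<A> b lam Y"
    "rank Y \<noteq> 1 \<Longrightarrow> P2_objective \<A> b lam Z < P2_objective \<A> b lam Y"
proof -
  let ?\<phi> = "P2_objective \<A> b lam"
  have descent: "\<exists>W. psd W \<and> Re (trace W) \<le> Re (trace X) \<and> ?\<phi> W < ?\<phi> X"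
    if X: "psd X" "?\<phi> X \<le> \<epsilon>\<^sup>2 / 2" "rank X \<noteq> 1" for X
  proof -
    have res: "norm (\<A> X - b) \<le> \<epsilon>" using norm_residual_le X lam(2) eps(1) by blast
    have "X \<noteq> 0"
    proof
      assume "X = 0"
      then have "\<A> X = 0"
        using op_norm_bound[OF lin, of X] X(1) by (simp add: psd_def)
      then show False using res eps(2) by simp
    qed
    have "op_norm \<A> * norm (\<A> X - b) < lam * (sqrt 2 - 1)"
      using mult_left_mono[OF res op_norm_nonneg[OF lin]] lam(1) by linarith
    then show ?thesis
      using P2_descent[OF lin X(1) \<open>X \<noteq> 0\<close> X(3) _ lam(2)] by metis
  qed
  define S where "S = {X :: complex^'n^'n. psd X \<and> Re (trace X) \<le> Re (trace Y)}"
  have "compact S" unfolding S_def by (rule compact_psd_trace_le)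
  moreover have "Y \<in> S" using Y by (simp add: S_def)
  moreover have "continuous_on S ?\<phi>"
    by (rule continuous_on_P2_objective[OF lin]) (simp add: S_def psd_def)
  ultimately obtain Z where Z: "Z \<in> S" and min: "\<And>X. X \<in> S \<Longrightarrow> ?\<phi> Z \<le> ?\<phi> X"
    using continuous_attains_inf[of S ?\<phi>] by blast
  have "?\<phi> Z \<le> ?\<phi> Y" using min \<open>Y \<in> S\<close> .
  have "rank Z = 1"
  proof (rule ccontr)
    assume "rank Z \<noteq> 1"
    then obtain W where "psd W" "Re (trace W) \<le> Re (trace Z)" "?\<phi> W < ?\<phi> Z"
      using descent[of Z] Z Y(2) \<open>?\<phi> Z \<le> ?\<phi> Y\<close> by (auto simp: S_def)
    then show False using min[of W] Z by (simp add: S_def)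
  qed
  moreover have "?\<phi> Z < ?\<phi> Y" if rank_Y: "rank Y \<noteq> 1"
  proof -
    obtain W where W: "psd W" "Re (trace W) \<le> Re (trace Y)" "?\<phi> W < ?\<phi> Y"
      using descent[OF Y rank_Y] by blast
    then show ?thesis using min[of W] by (simp add: S_def)
  qed
  moreover have "psd Z" using Z by (simp add: S_def)
  ultimately show thesis using that \<open>?\<phi> Z \<le> ?\<phi> Y\<close> by blast
qed

theorem theorem3p1:
  fixes \<A> :: "complex^'n^'n \<Rightarrow> real^'m"
    and xhat :: "complex^'n" and Xhat :: "complex^'n^'n"
    and e b :: "real^'m" and lam :: real
  assumes "linear_on_hermitian \<A>"
    and "Xhat = outer xhat"
    and "b = \<A> Xhat + e"
    and "norm b > norm e"
    and "lam > op_norm \<A> * norm e / (sqrt 2 - 1)"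
  shows "(\<forall>Xopt \<in> P2_solutions \<A> b lam. rank Xopt = 1) \<and>
    P1_solutions \<A> b = P2_solutions \<A> b lam"
proof -
  let ?\<phi> = "P2_objective \<A> b lam"
  have lin: "linear_on_hermitian \<A>" by fact
  have lam: "op_norm \<A> * norm e < lam * (sqrt 2 - 1)"
    using assms(5) by (simp add: pos_divide_less_eq)
  have "0 \<le> op_norm \<A> * norm e / (sqrt 2 - 1)"
    using op_norm_nonneg[OF lin] by simp
  then have "lam \<ge> 0" using assms(5) by simp
  have "Xhat \<noteq> 0"
  proof
    assume "Xhat = 0"
    then have "\<A> Xhat = 0"
      using op_norm_bound[OF lin, of Xhat] hermitian_outer[of xhat] assms(2) by simp
    then show False using assms(3,4) by simp
  qed
  then have Xhat: "psd Xhat" "rank Xhat = 1"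
    using assms(2) psd_outer rank_outer by auto
  have phi_Xhat: "?\<phi> Xhat = (norm e)\<^sup>2 / 2"
    by (simp add: P2_objective_rank_1[OF Xhat] P1_objective_def assms(3))
  \<comment> \<open>above the level of \<open>Xhat\<close>, the matrix \<open>Xhat\<close> itself is the dominating one\<close>
  have dominated: "\<exists>Z. psd Z \<and> rank Z = 1 \<and> ?\<phi> Z \<le> ?\<phi> Y \<and> (rank Y \<noteq> 1 \<longrightarrow> ?\<phi> Z < ?\<phi> Y)"
    if "psd Y" for Y
  proof (cases "?\<phi> Y \<le> (norm e)\<^sup>2 / 2")
    case True
    then show ?thesis
      using rank_1_dominates[OF lin lam \<open>lam \<ge> 0\<close> norm_ge_zero assms(4) that] by metis
  next
    case False
    then show ?thesis using Xhat phi_Xhat by (intro exI[of _ Xhat]) simp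
  qed
  have P2_iff: "X \<in> P2_solutions \<A> b lam \<longleftrightarrow> psd X \<and> (\<forall>Y. psd Y \<longrightarrow> ?\<phi> X \<le> ?\<phi> Y)" for X
    by (auto simp: P2_solutions_def is_arg_min_linorder)
  have P1_iff: "X \<in> P1_solutions \<A> b
      \<longleftrightarrow> psd X \<and> rank X = 1 \<and> (\<forall>Y. psd Y \<and> rank Y = 1 \<longrightarrow> ?\<phi> X \<le> ?\<phi> Y)" for X
    by (auto simp: P1_solutions_def is_arg_min_linorder P1_feasible_def P2_objective_rank_1)
  have rank_P2: "rank X = 1" if "X \<in> P2_solutions \<A> b lam" for X
    using that dominated[of X] unfolding P2_iff by (meson leD)
  moreover have "X \<in> P1_solutions \<A> b \<longleftrightarrow> X \<in> P2_solutions \<A> b lam" for X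
    using rank_P2[of X] dominated unfolding P1_iff P2_iff by (meson order_trans)
  ultimately show ?thesis by blast
qed

end
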